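(* Let $p,q\ge0$ with $p+q>0$. Then the family $\{C^*_{p,q}(t), t\in\mathbb R\}$ of operators in $C[-\infty,+\infty]$ (defined in the context) is a strongly continuous cosine family with generator $\Delta^*_{p,q}$ (defined in the context). In addition, $$\|C^*_{p,q}(t)\|\le M,\qquad t\in\mathbb R,\qquad\text{where } M=M(p,q)=\frac{2\max(p,q)}{p+q}.$$
   Context: $C[-\infty,+\infty]$ is the space of continuous functions on $\mathbb R$ that have finite limits at $+\infty$ and at $-\infty$, with the supremum norm. For $t\ge0$ and $f\in C[-\infty,+\infty]$, $$C^*_{p,q}(t)f(x)=\begin{cases}\frac12(f(x+t)+f(x-t)), & |x|\ge t,\\[2pt] \frac12(f(x+t)+f(x-t))+\dfrac{q-p}{2(p+q)}[f(-x-t)-f(x+t)], & -t<x\le0,\\[6pt] \frac12(f(x+t)+f(x-t))+\dfrac{p-q}{2(p+q)}[f(t-x)-f(x-t)], & 0<x<t,\end{cases}$$ and $C^*_{p,q}(-t)=C^*_{p,q}(t)$. These operators leave $C[-\infty,+\infty]$ invariant. Operator $\Delta^*_{p,q}$: $f\in C[-\infty,+\infty]$ belongs to $\mathcal D(\Delta^*_{p,q})$ iff (a) $f$ is twice continuously differentiable in $(-\infty,0]$ and in $[0,\infty)$, separately, with left-hand and right-hand derivatives at $x=0$, respectively; (b) the limits $\lim_{x\to\infty}f''(x)$ and $\lim_{x\to-\infty}f''(x)$ exist and are finite; (c) $pf'(0+)=qf'(0-)$ and $f''(0+)=f''(0-)$. For such $f$, $\Delta^*_{p,q}f=f''$. A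 strongly continuous cosine family in a Banach space is a strongly continuous family $\{C(t),t\in\mathbb R\}$ of bounded linear operators with $C(0)=I$ and $2C(t)C(s)=C(t+s)+C(t-s)$ for all $s,t\in\mathbb R$; a bounded one has generator $\Delta$ iff $\lambda(\lambda^2-\Delta)^{-1}=\int_0^\infty e^{-\lambda t}C(t)\,dt$ (strongly) for all $\lambda>0$. *)

theory Defs
  imports "HOL-Analysis.Analysis"
begin

typedef cfun_lim =
  "{f :: real \<Rightarrow> real. continuous_on UNIV f \<and>
      (\<exists>l. (f \<longlongrightarrow> l) at_top) \<and> (\<exists>l. (f \<longlongrightarrow> l) at_bot)}"
  morphisms app Abs_cfun_lim
  by (rule exI[of _ "\<lambda>_. 0"]) auto

setup_lifting type_definition_cfun_lim

lemma cfun_lim_eqI: "(\<And>x. app f x = app g x) \<Longrightarrow> f = g"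
  by (simp add: app_inject[symmetric] fun_eq_iff)

lemma bounded_range_of_limits:
  fixes f :: "real \<Rightarrow> real"
  assumes c: "continuous_on UNIV f" and t: "(f \<longlongrightarrow> l) at_top" and b: "(f \<longlongrightarrow> m) at_bot"
  shows "bounded (range f)"
proof -
  from tendstoD[OF t, of 1] obtain B where B: "\<And>x. x \<ge> B \<Longrightarrow> dist (f x) l < 1"
    by (auto simp: eventually_at_top_linorder)
  from tendstoD[OF b, of 1] obtain A where A: "\<And>x. x \<le> A \<Longrightarrow> dist (f x) m < 1"
    by (auto simp: eventually_at_bot_linorder)
  have "bounded (f ` {A..B})"
    by (intro compact_imp_bounded compact_continuous_image continuous_on_subset[OF c]) auto
  then have "bounded (f ` {A..B} \<union> ball l 1 \<union> ball m 1)"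
    by (simp add: bounded_Un)
  moreover have "range f \<subseteq> f ` {A..B} \<union> ball l 1 \<union> ball m 1"
  proof
    fix y assume "y \<in> range f"
    then obtain x where y: "y = f x" by auto
    have "x \<le> A \<or> x \<in> {A..B} \<or> x \<ge> B" by auto
    then show "y \<in> f ` {A..B} \<union> ball l 1 \<union> ball m 1"
      using A[of x] B[of x] by (auto simp: y dist_commute)
  qed
  ultimately show ?thesis by (rule bounded_subset)
qed

lemma bounded_range_app: "bounded (range (app f))"
  using app[of f] by (auto intro: bounded_range_of_limits)

lemma bdd_above_app: "bdd_above (range (\<lambda>x. \<bar>app f x\<bar>))"
  using bounded_range_app[of f] by (auto simp: bounded_iff bdd_above_def)

instantiation cfun_lim :: real_vector
begin

lift_definition zero_cfun_lim :: cfun_lim is "\<lambda>_. 0" by auto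
lift_definition plus_cfun_lim :: "cfun_lim \<Rightarrow> cfun_lim \<Rightarrow> cfun_lim" is "\<lambda>f g x. f x + g x"
  by (auto intro!: continuous_intros; blast intro: tendsto_intros)
lift_definition minus_cfun_lim :: "cfun_lim \<Rightarrow> cfun_lim \<Rightarrow> cfun_lim" is "\<lambda>f g x. f x - g x"
  by (auto intro!: continuous_intros; blast intro: tendsto_intros)
lift_definition uminus_cfun_lim :: "cfun_lim \<Rightarrow> cfun_lim" is "\<lambda>f x. - f x"
  by (auto intro!: continuous_intros; blast intro: tendsto_intros)
lift_definition scaleR_cfun_lim :: "real \<Rightarrow> cfun_lim \<Rightarrow> cfun_lim" is "\<lambda>r f x. r * f x"
  using tendsto_mult_left by (auto intro!: continuous_intros; blast)

lemmas app_simps [simp] =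
  zero_cfun_lim.rep_eq plus_cfun_lim.rep_eq minus_cfun_lim.rep_eq
  uminus_cfun_lim.rep_eq scaleR_cfun_lim.rep_eq

instance
  by standard (auto intro!: cfun_lim_eqI simp: algebra_simps)

end

instantiation cfun_lim :: real_normed_vector
begin

definition norm_cfun_lim :: "cfun_lim \<Rightarrow> real"
  where "norm (f :: cfun_lim) = (SUP x. \<bar>app f x\<bar>)"

definition dist_cfun_lim :: "cfun_lim \<Rightarrow> cfun_lim \<Rightarrow> real"
  where "dist (f :: cfun_lim) g = norm (f - g)"

definition sgn_cfun_lim :: "cfun_lim \<Rightarrow> cfun_lim"
  where "sgn (f :: cfun_lim) = f /\<^sub>R norm f"

definition uniformity_cfun_lim :: "(cfun_lim \<times> cfun_lim) filter"
  where "(uniformity :: (cfun_lim \<times> cfun_lim) filter) = (INF e\<in>{0 <..}. principal {(x, y). dist x y < e})"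

definition open_cfun_lim :: "cfun_lim set \<Rightarrow> bool"
  where "open (S :: cfun_lim set) = (\<forall>x\<in>S. \<forall>\<^sub>F (x', y) in uniformity. x' = x \<longrightarrow> y \<in> S)"

lemma abs_app_le_norm: "\<bar>app f x\<bar> \<le> norm f"
  unfolding norm_cfun_lim_def by (rule cSUP_upper[OF _ bdd_above_app]) simp

lemma norm_cfun_lim_le: "(\<And>x. \<bar>app f x\<bar> \<le> b) \<Longrightarrow> norm f \<le> b"
  unfolding norm_cfun_lim_def by (rule cSUP_least) auto

instance
proof
  fix f g :: cfun_lim and a :: real
  show "dist f g = norm (f - g)" by (rule dist_cfun_lim_def)
  show "sgn f = f /\<^sub>R norm f" by (rule sgn_cfun_lim_def)
  show "(uniformity :: (cfun_lim \<times> cfun_lim) filter)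
      = (INF e\<in>{0 <..}. principal {(x, y). dist x y < e})"
    by (rule uniformity_cfun_lim_def)
  show "open U = (\<forall>x\<in>U. \<forall>\<^sub>F (x', y) in uniformity. x' = x \<longrightarrow> y \<in> U)" for U :: "cfun_lim set"
    by (rule open_cfun_lim_def)
  show "norm f = 0 \<longleftrightarrow> f = 0"
  proof
    assume "norm f = 0"
    then show "f = 0" using abs_app_le_norm[of f] by (auto intro!: cfun_lim_eqI)
  qed (simp add: norm_cfun_lim_def)
  show "norm (f + g) \<le> norm f + norm g"
  proof (rule norm_cfun_lim_le)
    fix x
    show "\<bar>app (f + g) x\<bar> \<le> norm f + norm g"
      using abs_app_le_norm[of f x] abs_app_le_norm[of g x] by simp
  qed
  have le: "norm (c *\<^sub>R h) \<le> \<bar>c\<bar> * norm h" for c :: real and h :: cfun_lim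
    by (rule norm_cfun_lim_le) (simp add: abs_mult mult_left_mono abs_app_le_norm)
  show "norm (a *\<^sub>R f) = \<bar>a\<bar> * norm f"
  proof (cases "a = 0")
    case True
    then show ?thesis by (simp add: norm_cfun_lim_def)
  next
    case False
    have "norm f = norm (inverse a *\<^sub>R (a *\<^sub>R f))" using False by simp
    also have "\<dots> \<le> \<bar>inverse a\<bar> * norm (a *\<^sub>R f)" by (rule le)
    finally have "\<bar>a\<bar> * norm f \<le> norm (a *\<^sub>R f)"
      using False by (simp add: field_simps)
    with le[of a f] show ?thesis by simp
  qed
qed

end

instance cfun_lim :: banach
proof
  fix f :: "nat \<Rightarrow> cfun_lim"
  assume C: "Cauchy f"
  have d: "dist (app u x) (app v x) \<le> dist u v" for u v x
    using abs_app_le_norm[of "u - v" x] by (simp add: dist_norm)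
  have "\<exists>N. \<forall>m\<ge>N. \<forall>n\<ge>N. \<forall>x. dist (app (f m) x) (app (f n) x) < e" if "e > 0" for e
    using C that unfolding Cauchy_def by (meson d le_less_trans)
  then have "uniformly_Cauchy_on UNIV (\<lambda>n. app (f n))"
    by (intro uniformly_Cauchy_onI) blast
  then obtain g where g: "uniform_limit UNIV (\<lambda>n. app (f n)) g sequentially"
    using Cauchy_uniformly_convergent uniformly_convergent_on_def by blast
  have cont: "continuous_on UNIV g"
    by (rule uniform_limit_theorem[OF _ g]) (use app in auto)
  have lim: "\<exists>l. (g \<longlongrightarrow> l) G"
    if G: "\<And>u. \<exists>l. (app u \<longlongrightarrow> l) G" and nt: "G \<noteq> bot" for G :: "real filter"
  proof -
    from G have "\<forall>n. \<exists>l. (app (f n) \<longlongrightarrow> l) G" by blast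
    then obtain L where L: "\<And>n. (app (f n) \<longlongrightarrow> L n) G" by metis
    have "dist (L m) (L n) \<le> dist (f m) (f n)" for m n
      by (rule tendsto_upperbound[OF tendsto_dist[OF L L] _ nt]) (simp add: d)
    then have "Cauchy L"
      using C unfolding Cauchy_def by (meson le_less_trans)
    then obtain l where l: "L \<longlonglongrightarrow> l"
      using Cauchy_convergent convergent_def by blast
    have "(g \<longlongrightarrow> l) G"
      by (rule swap_uniform_limit'[OF _ l g]) (auto simp: L)
    then show ?thesis ..
  qed
  have "(\<exists>l. (g \<longlongrightarrow> l) at_top) \<and> (\<exists>l. (g \<longlongrightarrow> l) at_bot)"
    by (intro conjI lim) (use app in auto)
  with cont have "app (Abs_cfun_lim g) = g"
    by (intro Abs_cfun_lim_inverse) auto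
  then have g': "uniform_limit UNIV (\<lambda>n. app (f n)) (app (Abs_cfun_lim g)) sequentially"
    using g by simp
  have "f \<longlonglongrightarrow> Abs_cfun_lim g"
  proof (rule tendstoI)
    fix e :: real assume e: "e > 0"
    then have "\<forall>\<^sub>F n in sequentially. \<forall>x\<in>UNIV. dist (app (f n) x) (app (Abs_cfun_lim g) x) < e / 2"
      by (intro uniform_limitD[OF g']) simp
    then show "\<forall>\<^sub>F n in sequentially. dist (f n) (Abs_cfun_lim g) < e"
    proof eventually_elim
      case (elim n)
      have "norm (f n - Abs_cfun_lim g) \<le> e / 2"
        by (rule norm_cfun_lim_le) (use elim in \<open>auto simp: dist_real_def less_imp_le\<close>)
      then show ?case using e by (simp add: dist_norm)
    qed
  qed
  then show "convergent f" by (rule convergentI)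
qed

definition strongly_continuous_cosine_family :: "(real \<Rightarrow> 'a::banach \<Rightarrow> 'a) \<Rightarrow> bool"
  where "strongly_continuous_cosine_family C \<longleftrightarrow>
    (\<forall>t. bounded_linear (C t)) \<and>
    (\<forall>f. continuous_on UNIV (\<lambda>t. C t f)) \<and>
    (\<forall>f. C 0 f = f) \<and>
    (\<forall>t s f. 2 *\<^sub>R C t (C s f) = C (t + s) f + C (t - s) f)"

text \<open>
  An unbounded operator is given by its domain \<open>D\<close> and a map \<open>A\<close>, whose values outside \<open>D\<close>
  are irrelevant.  For a bounded cosine family \<open>C\<close>, the generator is the operator with
  \<open>r (r\<^sup>2 - A)\<^sup>-\<^sup>1 = \<integral>\<^sub>0\<^sup>\<infinity> exp (-r t) C(t) dt\<close> in the strong sense for all \<open>r > 0\<close>.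
\<close>

definition cosine_generator ::
    "(real \<Rightarrow> 'a::banach \<Rightarrow> 'a) \<Rightarrow> 'a set \<Rightarrow> ('a \<Rightarrow> 'a) \<Rightarrow> bool"
  where "cosine_generator C D A \<longleftrightarrow>
    (\<exists>K. \<forall>t. onorm (C t) \<le> K) \<and>
    (\<forall>r>0. bij_betw (\<lambda>f. r\<^sup>2 *\<^sub>R f - A f) D UNIV \<and>
      (\<forall>g. ((\<lambda>t. exp (- r * t) *\<^sub>R C t g) has_integral
              r *\<^sub>R inv_into D (\<lambda>f. r\<^sup>2 *\<^sub>R f - A f) g) {0..}))"

definition cos_skew_fun :: "real \<Rightarrow> real \<Rightarrow> real \<Rightarrow> (real \<Rightarrow> real) \<Rightarrow> real \<Rightarrow> real"
  where "cos_skew_fun p q t f x =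
    (if \<bar>x\<bar> \<ge> t then (f (x + t) + f (x - t)) / 2
     else if x \<le> 0 then
       (f (x + t) + f (x - t)) / 2 + (q - p) / (2 * (p + q)) * (f (- x - t) - f (x + t))
     else
       (f (x + t) + f (x - t)) / 2 + (p - q) / (2 * (p + q)) * (f (t - x) - f (x - t)))"

lemma cos_skew_fun_invariant:
  assumes t: "t \<ge> 0" and f: "continuous_on UNIV f"
    and ft: "(f \<longlongrightarrow> l) at_top" and fb: "(f \<longlongrightarrow> m) at_bot"
  shows "continuous_on UNIV (cos_skew_fun p q t f)"
    and "(cos_skew_fun p q t f \<longlongrightarrow> l) at_top"
    and "(cos_skew_fun p q t f \<longlongrightarrow> m) at_bot"
proof -
  define c where "c = (q - p) / (2 * (p + q))"
  have c': "(p - q) / (2 * (p + q)) = - c"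
    unfolding c_def by (simp add: minus_divide_left)
  have fc: "continuous_on S (\<lambda>x. f (h x))" if "continuous_on S h" for h and S :: "real set"
    using continuous_on_compose2[OF f that] by simp
  have "cos_skew_fun p q t f = (\<lambda>x. (f (x + t) + f (x - t)) / 2
      + c * (f (- max 0 (t - \<bar>x\<bar>) ) - f (max 0 (t - \<bar>x\<bar>))))"
    using t unfolding cos_skew_fun_def c' c_def[symmetric]
    by (auto simp: fun_eq_iff max_def abs_if algebra_simps)
  then show "continuous_on UNIV (cos_skew_fun p q t f)"
    by (auto intro!: continuous_intros fc)
  have ev_top: "\<forall>\<^sub>F x in at_top. (f (x + t) + f (x - t)) / 2 = cos_skew_fun p q t f x"
    using eventually_ge_at_top[of t] by eventually_elim (auto simp: cos_skew_fun_def)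
  have "filterlim (\<lambda>x. x + a) at_top at_top" for a :: real
    unfolding filterlim_at_top eventually_at_top_linorder
    by (metis diff_le_eq)
  from this[of t] this[of "- t"]
  have "((\<lambda>x. (f (x + t) + f (x - t)) / 2) \<longlongrightarrow> (l + l) / 2) at_top"
    by (intro tendsto_intros filterlim_compose[OF ft]) auto
  then show "(cos_skew_fun p q t f \<longlongrightarrow> l) at_top"
    using Lim_transform_eventually[OF _ ev_top] by simp
  have ev_bot: "\<forall>\<^sub>F x in at_bot. (f (x + t) + f (x - t)) / 2 = cos_skew_fun p q t f x"
    using eventually_le_at_bot[of "- t"] by eventually_elim (auto simp: cos_skew_fun_def)
  have "filterlim (\<lambda>x. x + a) at_bot at_bot" for a :: real
    unfolding filterlim_at_bot eventually_at_bot_linorder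
    by (metis le_diff_eq)
  from this[of t] this[of "- t"]
  have "((\<lambda>x. (f (x + t) + f (x - t)) / 2) \<longlongrightarrow> (m + m) / 2) at_bot"
    by (intro tendsto_intros filterlim_compose[OF fb]) auto
  then show "(cos_skew_fun p q t f \<longlongrightarrow> m) at_bot"
    using Lim_transform_eventually[OF _ ev_bot] by simp
qed

text \<open>The absolute value encodes \<open>C\<^sup>*\<^sub>p\<^sub>,\<^sub>q(-t) = C\<^sup>*\<^sub>p\<^sub>,\<^sub>q(t)\<close>.\<close>

lift_definition cos_skew :: "real \<Rightarrow> real \<Rightarrow> real \<Rightarrow> cfun_lim \<Rightarrow> cfun_lim"
  is "\<lambda>p q t f. cos_skew_fun p q \<bar>t\<bar> f"
  using cos_skew_fun_invariant[OF abs_ge_zero] by blast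

text \<open>
  Derivatives relative to a half-line \<open>S\<close> with end point \<open>0\<close>: ordinary derivatives away
  from \<open>0\<close>, one-sided at \<open>0\<close>.
\<close>

definition deriv_on :: "real set \<Rightarrow> (real \<Rightarrow> real) \<Rightarrow> real \<Rightarrow> real"
  where "deriv_on S f x = vector_derivative f (at x within S)"

definition C2_on :: "real set \<Rightarrow> (real \<Rightarrow> real) \<Rightarrow> bool"
  where "C2_on S f \<longleftrightarrow> f differentiable_on S \<and> deriv_on S f differentiable_on S \<and>
    continuous_on S (deriv_on S (deriv_on S f))"

definition second_deriv :: "(real \<Rightarrow> real) \<Rightarrow> real \<Rightarrow> real"
  where "second_deriv f x =
    (if x \<le> 0 then deriv_on {..0} (deriv_on {..0} f) x
     else deriv_on {0..} (deriv_on {0..} f) x)"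

definition dom_Laplace_skew :: "real \<Rightarrow> real \<Rightarrow> cfun_lim set"
  where "dom_Laplace_skew p q = {f.
    C2_on {..0} (app f) \<and> C2_on {0..} (app f) \<and>
    (\<exists>l. (second_deriv (app f) \<longlongrightarrow> l) at_top) \<and>
    (\<exists>l. (second_deriv (app f) \<longlongrightarrow> l) at_bot) \<and>
    p * deriv_on {0..} (app f) 0 = q * deriv_on {..0} (app f) 0 \<and>
    deriv_on {0..} (deriv_on {0..} (app f)) 0 = deriv_on {..0} (deriv_on {..0} (app f)) 0}"

definition Laplace_skew :: "cfun_lim \<Rightarrow> cfun_lim"
  where "Laplace_skew f = Abs_cfun_lim (second_deriv (app f))"

lemma app_Laplace_skew:
  assumes "f \<in> dom_Laplace_skew p q"
  shows "app (Laplace_skew f) = second_deriv (app f)"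
proof -
  let ?L = "deriv_on {..0} (deriv_on {..0} (app f))"
  let ?R = "deriv_on {0..} (deriv_on {0..} (app f))"
  have c: "continuous_on {..0} ?L" "continuous_on {0..} ?R" "?R 0 = ?L 0"
    using assms by (auto simp: dom_Laplace_skew_def C2_on_def)
  have "continuous_on ({..0} \<union> {0..}) (\<lambda>x. if x \<le> 0 then ?L x else ?R x)"
    by (rule continuous_on_If) (use c in auto)
  moreover have "{..0} \<union> {0..} = (UNIV :: real set)" by auto
  ultimately have "continuous_on UNIV (second_deriv (app f))"
    unfolding second_deriv_def by simp
  then show ?thesis
    unfolding Laplace_skew_def using assms
    by (intro Abs_cfun_lim_inverse) (auto simp: dom_Laplace_skew_def)
qed

end

theory Submission
  imports Defs
begin

text \<open>
  Put \<open>k = (p - q) / (p + q)\<close>. The map \<open>skew k f x = f x + k/2 (f \<bar>x\<bar> - f (- \<bar>x\<bar>))\<close> adds to \<open>f\<close> a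
  multiple of the even reflection of its odd part; it is invertible with inverse \<open>skew (- k)\<close>, and it
  conjugates the given family to d'Alembert's cosine family \<open>cos_std t f x = (f (x + t) + f (x - t)) / 2\<close>. It also
  turns the transmission condition \<open>p f' (0+) = q f' (0-)\<close> into differentiability at \<open>0\<close>, so everything
  reduces to the case \<open>p = q\<close>. There the Laplace transform of d'Alembert's family at \<open>v\<close> is the mean of
  \<open>a x = \<integral>\<^sub>0\<^sup>\<infinity> exp (-rt) v (x + t) dt\<close> and its mirror image \<open>b\<close>, which satisfy \<open>a' = ra - v\<close> and
  \<open>b' = v - rb\<close>; hence it solves the resolvent equation, and the solution is unique because
  \<open>u'' = r\<^sup>2u\<close> has no nonzero bounded solution.
\<close>

section \<open>Banach-valued integrals over a half-line\<close>

lemma tendsto_integral_atLeast: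
  fixes f :: "real \<Rightarrow> 'a::banach"
  assumes f: "(f has_integral J) {a..}"
  shows "((\<lambda>b. integral {a..b} f) \<longlongrightarrow> J) at_top"
proof (rule tendstoI)
  fix e :: real assume "e > 0"
  then obtain B where "B > 0" and B: "\<And>c d. ball 0 B \<subseteq> cbox c d \<Longrightarrow>
      norm (integral (cbox c d) (\<lambda>x. if x \<in> {a..} then f x else 0) - J) < e"
    using f[unfolded has_integral_alt'] by blast
  show "\<forall>\<^sub>F b in at_top. dist (integral {a..b} f) J < e"
    using eventually_ge_at_top[of B]
  proof eventually_elim
    case (elim b)
    \<comment> \<open>An integral over an unbounded set is tested on intervals that contain a large
      ball around \<open>0\<close>. Extending the left end to \<open>min a (-B)\<close> catches the
      ball without changing the intersection with \<open>{a..}\<close>.\<close>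
    have "ball 0 B \<subseteq> cbox (min a (-B)) b"
      using elim by (auto simp: ball_def dist_real_def)
    moreover have "{a..} \<inter> cbox (min a (-B)) b = {a..b}"
      by auto
    ultimately show ?case
      using B[of "min a (-B)" b] by (simp only: integral_restrict_Int dist_norm)
  qed
qed

text \<open>Existence comes from the Cauchy criterion in the Banach space: the integral over
  \<open>{b..d}\<close> is bounded by that of \<open>K * exp (- r * t)\<close>, hence by
  \<open>K * (exp (- r * b) / r)\<close>, which is small for large \<open>b\<close>.\<close>

lemma integrable_exp_decay:
  fixes F :: "real \<Rightarrow> 'a::banach"
  assumes c: "continuous_on {0..} F" and K: "\<And>t. t \<ge> 0 \<Longrightarrow> norm (F t) \<le> K" and r: "r > 0"
  shows "(\<lambda>t. exp (- r * t) *\<^sub>R F t) integrable_on {0..}"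
proof -
  let ?f = "\<lambda>t. exp (- r * t) *\<^sub>R F t"
  have K0: "K \<ge> 0"
    using K[of 0] norm_ge_zero[of "F 0"] by linarith
  have int: "?f integrable_on {a..b}" if "a \<ge> 0" for a b
    using that by (intro integrable_continuous_real continuous_intros continuous_on_subset[OF c]) auto
  have eq: "{0..} \<inter> cbox a b = {max 0 a..b}" for a b :: real
    by auto
  have tail: "norm (integral {0..b} ?f - integral {0..d} ?f) \<le> K * (exp (- r * b) / r)"
    if "0 \<le> b" "b \<le> d" for b d
  proof -
    have "integral {0..b} ?f + integral {b..d} ?f = integral {0..d} ?f"
      by (rule Henstock_Kurzweil_Integration.integral_combine) (use that int in auto)
    then have "norm (integral {0..b} ?f - integral {0..d} ?f) = norm (integral {b..d} ?f)"
      by (metis add_diff_cancel_left' norm_minus_commute)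
    also have "\<dots> \<le> integral {b..d} (\<lambda>t. K * exp (- r * t))"
      by (rule Henstock_Kurzweil_Integration.integral_norm_bound_integral)
         (use that K int in \<open>auto intro!: integrable_continuous_real continuous_intros
            simp: mult.commute[of K] mult_left_mono\<close>)
    also have "\<dots> = (- K * exp (- r * d) / r) - (- K * exp (- r * b) / r)"
      by (intro integral_unique fundamental_theorem_of_calculus)
         (use that r in \<open>auto intro!: derivative_eq_intros
            simp: has_real_derivative_iff_has_vector_derivative[symmetric]\<close>)
    also have "\<dots> \<le> K * (exp (- r * b) / r)"
      using K0 r by simp
    finally show ?thesis .
  qed
  show ?thesis
  proof (subst integrable_alt_subset, unfold integral_restrict_Int integrable_restrict_Int eq,
      intro conjI allI impI)
    fix e :: real assume "e > 0"
    have "((\<lambda>b. exp (- r * b) / r) \<longlongrightarrow> 0) at_top"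
      using r by real_asymp
    from tendsto_mult_right_zero[OF this]
    have "((\<lambda>b. K * (exp (- r * b) / r)) \<longlongrightarrow> 0) at_top" .
    from order_tendstoD(2)[OF this \<open>e > 0\<close>]
    obtain B where B: "\<And>b. b \<ge> B \<Longrightarrow> K * (exp (- r * b) / r) < e"
      by (auto simp: eventually_at_top_linorder)
    show "\<exists>B>0. \<forall>a b c d. ball 0 B \<subseteq> cbox a b \<and> cbox a b \<subseteq> cbox c d \<longrightarrow>
       norm (integral {max 0 a..b} ?f - integral {max 0 c..d} ?f) < e"
    \<comment> \<open>The \<open>1\<close> keeps the radius positive. Both nested intervals then
      extend below \<open>0\<close>, so their integrals start at \<open>0\<close> and differ by a
      single tail beyond \<open>B\<close>.\<close>
    proof (intro exI[of _ "max 1 B"] conjI allI impI)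
      fix a b c d :: real
      assume *: "ball 0 (max 1 B) \<subseteq> cbox a b \<and> cbox a b \<subseteq> cbox c d"
      have "ball 0 (max 1 B) = {- max 1 B <..< max 1 B}"
        by (auto simp: dist_real_def)
      then have "a \<le> - max 1 B" "max 1 B \<le> b"
        using * greaterThanLessThan_subseteq_atLeastAtMost_iff[of "- max 1 B" "max 1 B" a b] by auto
      moreover from this have "c \<le> a" "b \<le> d"
        using * by auto
      ultimately show "norm (integral {max 0 a..b} ?f - integral {max 0 c..d} ?f) < e"
        using tail[of b d] B[of b] by (simp add: max_def split: if_splits)
    qed auto
  qed (use int in auto)
qed

section \<open>Translations and d'Alembert's cosine family\<close>

text \<open>Near the two infinities the limits control the oscillation, in between compactness does.
  This is what makes translations strongly continuous in the supremum norm.\<close>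

lemma uniformly_continuous_app: "uniformly_continuous_on UNIV (app f)"
proof -
  obtain l m where l: "(app f \<longlongrightarrow> l) at_top" and m: "(app f \<longlongrightarrow> m) at_bot"
    and c: "continuous_on UNIV (app f)"
    using app[of f] by auto
  show ?thesis
    unfolding uniformly_continuous_on_def
  proof (intro allI impI)
    fix e :: real assume e: "e > 0"
    obtain B where B: "\<And>x. x \<ge> B \<Longrightarrow> dist (app f x) l < e / 2"
      using tendstoD[OF l, of "e / 2"] e by (auto simp: eventually_at_top_linorder)
    obtain A where A: "\<And>x. x \<le> A \<Longrightarrow> dist (app f x) m < e / 2"
      using tendstoD[OF m, of "e / 2"] e by (auto simp: eventually_at_bot_linorder)
    have "uniformly_continuous_on {A - 1..B + 1} (app f)"
      by (intro compact_uniformly_continuous continuous_on_subset[OF c]) auto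
    then obtain d where "d > 0" and
      d: "\<And>x y. x \<in> {A - 1..B + 1} \<Longrightarrow> y \<in> {A - 1..B + 1} \<Longrightarrow> dist y x < d \<Longrightarrow> dist (app f y) (app f x) < e"
      using e unfolding uniformly_continuous_on_def by metis
    have "dist (app f y) (app f x) < e" if xy: "dist y x < min d 1" for x y
    proof -
      have "\<bar>y - x\<bar> < 1"
        using xy by (simp add: dist_real_def)
      \<comment> \<open>Points at distance less than \<open>1\<close> cannot straddle the margins of
        width \<open>1\<close>: they share the enlarged compact interval or one of the
        tails.\<close>
      then have "(A - 1 \<le> x \<and> x \<le> B + 1 \<and> A - 1 \<le> y \<and> y \<le> B + 1) \<or>
          (x \<ge> B \<and> y \<ge> B) \<or> (x \<le> A \<and> y \<le> A)"
        by linarith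
      then consider "x \<in> {A - 1..B + 1}" "y \<in> {A - 1..B + 1}" | "x \<ge> B" "y \<ge> B" | "x \<le> A" "y \<le> A"
        by auto
      then show ?thesis
        using d[of x y] xy dist_triangle_half_l[of _ l] dist_triangle_half_l[of _ m] A B
        by cases (auto simp: dist_commute intro: dist_triangle_half_l)
    qed
    then show "\<exists>d>0. \<forall>x\<in>UNIV. \<forall>x'\<in>UNIV. dist x' x < d \<longrightarrow> dist (app f x') (app f x) < e"
      using \<open>d > 0\<close> by (intro exI[of _ "min d 1"]) auto
  qed
qed

lemma bounded_linear_app: "bounded_linear (\<lambda>f. app f x)"
  by (rule bounded_linear_intro[of _ 1]) (auto simp: abs_app_le_norm)

lift_definition translate :: "real \<Rightarrow> cfun_lim \<Rightarrow> cfun_lim" is "\<lambda>t f x. f (x + t)"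
proof (safe)
  fix t l m :: real and f :: "real \<Rightarrow> real"
  assume f: "continuous_on UNIV f" "(f \<longlongrightarrow> l) at_top" "(f \<longlongrightarrow> m) at_bot"
  show "continuous_on UNIV (\<lambda>x. f (x + t))"
    by (rule continuous_on_compose2[OF f(1)]) (auto intro!: continuous_intros)
  have "filterlim (\<lambda>x. x + t) at_top at_top" "filterlim (\<lambda>x. x + t) at_bot at_bot"
    unfolding filterlim_at_top filterlim_at_bot eventually_at_top_linorder eventually_at_bot_linorder
    by (metis diff_le_eq, metis le_diff_eq)
  then show "\<exists>l. ((\<lambda>x. f (x + t)) \<longlongrightarrow> l) at_top" "\<exists>l. ((\<lambda>x. f (x + t)) \<longlongrightarrow> l) at_bot"
    using filterlim_compose[OF f(2)] filterlim_compose[OF f(3)] by blast+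
qed

lemma norm_translate_le: "norm (translate t f) \<le> norm f"
  by (rule norm_cfun_lim_le) (simp add: translate.rep_eq abs_app_le_norm)

lemma bounded_linear_translate: "bounded_linear (translate t)"
  by (rule bounded_linear_intro[of _ 1])
     (auto intro!: cfun_lim_eqI simp: translate.rep_eq norm_translate_le)

lemma continuous_on_translate: "continuous_on UNIV (\<lambda>t. translate t f)"
  unfolding continuous_on_iff
proof (intro ballI allI impI)
  fix t e :: real assume "e > 0"
  \<comment> \<open>Half of \<open>e\<close>, because a strict pointwise bound becomes a non-strict
    one for the supremum.\<close>
  then obtain d where "d > 0" and d: "\<And>x y. dist y x < d \<Longrightarrow> dist (app f y) (app f x) < e / 2"
    using uniformly_continuous_app[of f] unfolding uniformly_continuous_on_def
    by (metis UNIV_I half_gt_zero)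
  have "dist (translate s f) (translate t f) < e" if "dist s t < d" for s
  proof -
    have "norm (translate s f - translate t f) \<le> e / 2"
    proof (rule norm_cfun_lim_le)
      fix x
      show "\<bar>app (translate s f - translate t f) x\<bar> \<le> e / 2"
        using d[of "x + s" "x + t"] that by (simp add: translate.rep_eq dist_real_def)
    qed
    then show ?thesis using \<open>e > 0\<close> by (simp add: dist_norm)
  qed
  then show "\<exists>d>0. \<forall>s\<in>UNIV. dist s t < d \<longrightarrow> dist (translate s f) (translate t f) < e"
    using \<open>d > 0\<close> by blast
qed

definition cos_std :: "real \<Rightarrow> cfun_lim \<Rightarrow> cfun_lim"
  where "cos_std t f = (1/2) *\<^sub>R (translate t f + translate (- t) f)"

lemma app_cos_std: "app (cos_std t f) x = (app f (x + t) + app f (x - t)) / 2"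
  by (simp add: cos_std_def translate.rep_eq)

lemma bounded_linear_cos_std: "bounded_linear (cos_std t)"
  unfolding cos_std_def
  by (intro bounded_linear_intros bounded_linear_translate bounded_linear_scaleR_right[THEN bounded_linear_compose])

lemma continuous_on_cos_std: "continuous_on UNIV (\<lambda>t. cos_std t f)"
  unfolding cos_std_def
  by (intro continuous_intros continuous_on_translate
        continuous_on_compose2[OF continuous_on_translate, of _ uminus]) auto

lemma norm_cos_std_le: "norm (cos_std t f) \<le> norm f"
  using norm_triangle_ineq[of "translate t f" "translate (-t) f"]
    norm_translate_le[of t f] norm_translate_le[of "-t" f]
  by (simp add: cos_std_def)

section \<open>The conjugation \<open>skew\<close>, the cosine identity and the norm bound\<close>

lift_definition skew :: "real \<Rightarrow> cfun_lim \<Rightarrow> cfun_lim"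
  is "\<lambda>k f x. f x + k / 2 * (f \<bar>x\<bar> - f (- \<bar>x\<bar>))"
proof (safe)
  fix k l m :: real and f :: "real \<Rightarrow> real"
  assume f: "continuous_on UNIV f" "(f \<longlongrightarrow> l) at_top" "(f \<longlongrightarrow> m) at_bot"
  show "continuous_on UNIV (\<lambda>x. f x + k / 2 * (f \<bar>x\<bar> - f (- \<bar>x\<bar>)))"
    by (intro continuous_intros f(1) continuous_on_compose2[OF f(1)]) auto
  have abs_bot: "filterlim (\<lambda>x::real. \<bar>x\<bar>) at_top at_bot"
    using filterlim_abs_real by (simp add: filterlim_at_bot_mirror)
  have neg: "filterlim (\<lambda>x::real. - \<bar>x\<bar>) at_bot F" if "filterlim (\<lambda>x::real. \<bar>x\<bar>) at_top F" for F
    using that by (simp add: filterlim_uminus_at_top)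
  have "((\<lambda>x. f x + k / 2 * (f \<bar>x\<bar> - f (- \<bar>x\<bar>))) \<longlongrightarrow> l + k / 2 * (l - m)) at_top"
    by (intro tendsto_add tendsto_mult_left tendsto_diff f(2) filterlim_compose[OF f(2)]
        filterlim_compose[OF f(3)] neg filterlim_abs_real)
  moreover have "((\<lambda>x. f x + k / 2 * (f \<bar>x\<bar> - f (- \<bar>x\<bar>))) \<longlongrightarrow> m + k / 2 * (l - m)) at_bot"
    by (intro tendsto_add tendsto_mult_left tendsto_diff f(3) filterlim_compose[OF f(2)]
        filterlim_compose[OF f(3)] neg abs_bot)
  ultimately show "\<exists>l. ((\<lambda>x. f x + k / 2 * (f \<bar>x\<bar> - f (- \<bar>x\<bar>))) \<longlongrightarrow> l) at_top"
    and "\<exists>l. ((\<lambda>x. f x + k / 2 * (f \<bar>x\<bar> - f (- \<bar>x\<bar>))) \<longlongrightarrow> l) at_bot"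
    by blast+
qed

text \<open>The summand added to \<open>f\<close> is even and depends only on the odd part of
  \<open>f\<close>. So \<open>skew\<close> leaves the odd part unchanged, and applying it with the
  opposite sign removes the same summand.\<close>

lemma skew_skew_minus [simp]: "skew k (skew (- k) f) = f" "skew (- k) (skew k f) = f"
  by (rule cfun_lim_eqI, simp add: skew.rep_eq abs_if field_simps)+

lemma bounded_linear_skew: "bounded_linear (skew k)"
proof (rule bounded_linear_intro[of _ "1 + \<bar>k\<bar>"])
  fix f
  show "norm (skew k f) \<le> norm f * (1 + \<bar>k\<bar>)"
  proof (rule norm_cfun_lim_le)
    fix x
    have "\<bar>k / 2 * (app f \<bar>x\<bar> - app f (- \<bar>x\<bar>))\<bar> \<le> \<bar>k / 2\<bar> * (norm f + norm f)"
      unfolding abs_mult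
      by (intro mult_left_mono order.trans[OF abs_triangle_ineq4] add_mono abs_app_le_norm) auto
    then show "\<bar>app (skew k f) x\<bar> \<le> norm f * (1 + \<bar>k\<bar>)"
      using abs_app_le_norm[of f x] by (simp add: skew.rep_eq algebra_simps)
  qed
qed (auto intro!: cfun_lim_eqI simp: skew.rep_eq algebra_simps)

text \<open>Let \<open>h\<close> be the odd part of \<open>f\<close>. As \<open>cos_std\<close>
  preserves parity, the conjugation adds to \<open>cos_std t f\<close>, for \<open>t >= 0\<close>,
  the term \<open>k/2 (h \<bar>x + t\<bar> + h \<bar>x - t\<bar>) - k/2 (h (\<bar>x\<bar> + t) + h
  (\<bar>x\<bar> - t))\<close>. It vanishes for \<open>\<bar>x\<bar> >= t\<close>; otherwise it is
  \<open>k h (t - \<bar>x\<bar>)\<close>, the correction in the inner branches.\<close>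

lemma cos_skew_conv:
  assumes k: "k = (p - q) / (p + q)"
  shows "cos_skew p q t f = skew (- k) (cos_std t (skew k f))"
proof (rule cfun_lim_eqI)
  fix x
  have k': "(q - p) / (2 * (p + q)) = - k / 2" "(p - q) / (2 * (p + q)) = k / 2"
    unfolding k by (simp_all add: minus_divide_left)
  have even: "cos_std t g = cos_std \<bar>t\<bar> g" for g
    by (simp add: cos_std_def abs_if add.commute)
  have "cos_skew_fun p q s (app f) x = app (skew (- k) (cos_std s (skew k f))) x" if "s \<ge> 0" for s
    unfolding cos_skew_fun_def k' skew.rep_eq app_cos_std
    using that by (cases "s = - x") (auto simp: abs_if field_simps minus_diff_commute)
  then show "app (cos_skew p q t f) x = app (skew (- k) (cos_std t (skew k f))) x"
    by (simp add: cos_skew.rep_eq even[of "skew k f"])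
qed

text \<open>Bounding the factors of the conjugation separately would give only
  \<open>(1 + \<bar>k\<bar>)\<^sup>2\<close>. In the explicit formula each inner value combines
  three values of \<open>f\<close>, with weights \<open>(1 + k)/2, 1/2, - k/2\<close> or
  \<open>(1 - k)/2, 1/2, k/2\<close>. For \<open>\<bar>k\<bar> <= 1\<close> their absolute values
  sum to at most \<open>1 + \<bar>k\<bar>\<close>, which is the claimed constant.\<close>

lemma norm_cos_skew_le:
  assumes pq: "p \<ge> 0" "q \<ge> 0" "p + q > 0"
  shows "norm (cos_skew p q t f) \<le> 2 * max p q / (p + q) * norm f"
proof (rule norm_cfun_lim_le)
  fix x
  define k where "k = (p - q) / (p + q)"
  have k': "(q - p) / (2 * (p + q)) = - k / 2" "(p - q) / (2 * (p + q)) = k / 2"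
    unfolding k_def by (simp_all add: minus_divide_left)
  have k1: "\<bar>k\<bar> \<le> 1"
    using pq by (auto simp: k_def abs_if field_simps)
  have M: "2 * max p q / (p + q) = 1 + \<bar>k\<bar>"
  proof -
    have "\<bar>k\<bar> = \<bar>p - q\<bar> / (p + q)"
      using pq by (simp add: k_def)
    moreover have "2 * max p q = (p + q) + \<bar>p - q\<bar>"
      by auto
    ultimately show ?thesis
      using pq by (simp add: add_divide_distrib)
  qed
  have b: "\<bar>u * app f y\<bar> \<le> \<bar>u\<bar> * norm f" for u y
    by (simp add: abs_mult mult_left_mono abs_app_le_norm)
  have three: "\<bar>u * app f y1 + app f y2 / 2 + v * app f y3\<bar> \<le> (1 + \<bar>k\<bar>) * norm f"
    if "\<bar>u\<bar> + 1/2 + \<bar>v\<bar> \<le> 1 + \<bar>k\<bar>" for u v y1 y2 y3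
  proof -
    have "\<bar>u * app f y1 + app f y2 / 2 + v * app f y3\<bar> \<le> (\<bar>u\<bar> + 1/2 + \<bar>v\<bar>) * norm f"
      using b[of u y1] b[of "1/2" y2] b[of v y3] by (simp add: algebra_simps)
    also have "\<dots> \<le> (1 + \<bar>k\<bar>) * norm f"
      by (rule mult_right_mono[OF that]) simp
    finally show ?thesis .
  qed
  consider "\<bar>t\<bar> \<le> \<bar>x\<bar>" | "\<bar>x\<bar> < \<bar>t\<bar>" "x \<le> 0" | "\<bar>x\<bar> < \<bar>t\<bar>" "x > 0"
    by linarith
  then show "\<bar>app (cos_skew p q t f) x\<bar> \<le> 2 * max p q / (p + q) * norm f"
  proof cases
    case 1
    then show ?thesis
      using three[of "1/2" 0 "x + \<bar>t\<bar>" "x - \<bar>t\<bar>" 0]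
      by (simp add: M cos_skew.rep_eq cos_skew_fun_def add_divide_distrib)
  next
    case 2
    have "app (cos_skew p q t f) x = (1/2 + k/2) * app f (x + \<bar>t\<bar>) + app f (x - \<bar>t\<bar>) / 2
        + (- k/2) * app f (- x - \<bar>t\<bar>)"
      using 2 unfolding cos_skew.rep_eq cos_skew_fun_def k' by (simp add: field_simps)
    then show ?thesis
      unfolding M using three[of "1/2 + k/2" "- k/2"] k1 by (simp add: abs_if split: if_splits)
  next
    case 3
    have "app (cos_skew p q t f) x = (1/2 - k/2) * app f (x - \<bar>t\<bar>) + app f (x + \<bar>t\<bar>) / 2
        + (k/2) * app f (\<bar>t\<bar> - x)"
      using 3 unfolding cos_skew.rep_eq cos_skew_fun_def k' by (simp add: field_simps)
    then show ?thesis
      unfolding M using three[of "1/2 - k/2" "k/2"] k1 by (simp add: abs_if split: if_splits)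
  qed
qed

text \<open>All axioms pass through the conjugation; in a product of two operators the inner
  \<open>skew k\<close> and \<open>skew (- k)\<close> cancel.\<close>

lemma cosine_family_cos_skew: "strongly_continuous_cosine_family (cos_skew p q)"
proof -
  define k where "k = (p - q) / (p + q)"
  note conv = cos_skew_conv[OF k_def]
  have "2 *\<^sub>R cos_std t (cos_std s g) = cos_std (t + s) g + cos_std (t - s) g" for t s g
    by (rule cfun_lim_eqI) (simp add: app_cos_std field_simps)
  then have "2 *\<^sub>R cos_skew p q t (cos_skew p q s f) = cos_skew p q (t + s) f + cos_skew p q (t - s) f"
    for t s f
    unfolding conv
    by (simp flip: linear_add[OF bounded_linear.linear[OF bounded_linear_skew]]
        linear_scale[OF bounded_linear.linear[OF bounded_linear_skew]])
  moreover have "bounded_linear (cos_skew p q t)" for t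
    unfolding conv
    by (intro bounded_linear_compose[OF bounded_linear_skew]
        bounded_linear_compose[OF bounded_linear_cos_std] bounded_linear_skew)
  moreover have "continuous_on UNIV (\<lambda>t. cos_skew p q t f)" for f
    unfolding conv by (intro bounded_linear.continuous_on[OF bounded_linear_skew] continuous_on_cos_std)
  moreover have "cos_std 0 f = f" for f
    by (rule cfun_lim_eqI) (simp add: app_cos_std)
  then have "cos_skew p q 0 f = f" for f
    by (simp add: conv)
  ultimately show ?thesis
    by (simp add: strongly_continuous_cosine_family_def)
qed

section \<open>One-sided derivatives and the graph of the generator\<close>

text \<open>The derivatives are explicit arguments, so that linear combinations and reflections
  follow from the derivative rules. Continuity of \<open>s\<close> is supplied separately, in
  \<open>Laplace_graph\<close> by taking \<open>s\<close> from the space.\<close>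

definition has_C2_on ::
    "real set \<Rightarrow> (real \<Rightarrow> real) \<Rightarrow> (real \<Rightarrow> real) \<Rightarrow> (real \<Rightarrow> real) \<Rightarrow> bool"
  where "has_C2_on S f d s \<longleftrightarrow> (\<forall>x\<in>S. (f has_real_derivative d x) (at x within S) \<and>
     (d has_real_derivative s x) (at x within S))"

lemma has_C2_on_cong:
  assumes "has_C2_on S f d s"
    and "\<And>x. x \<in> S \<Longrightarrow> f x = f' x" "\<And>x. x \<in> S \<Longrightarrow> d x = d' x" "\<And>x. x \<in> S \<Longrightarrow> s x = s' x"
  shows "has_C2_on S f' d' s'"
  unfolding has_C2_on_def
  using assms by (auto simp: has_C2_on_def intro: has_field_derivative_transform_within[OF _ zero_less_one])

lemma has_C2_on_lincomb:
  assumes "has_C2_on S f d s" "has_C2_on S g e t"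
  shows "has_C2_on S (\<lambda>x. a * f x + b * g x) (\<lambda>x. a * d x + b * e x) (\<lambda>x. a * s x + b * t x)"
  using assms unfolding has_C2_on_def by (auto intro!: derivative_eq_intros)

lemma has_C2_on_reflect:
  assumes "has_C2_on (uminus ` S) f d s"
  shows "has_C2_on S (\<lambda>x. f (- x)) (\<lambda>x. - d (- x)) (\<lambda>x. s (- x))"
proof -
  have chain: "((\<lambda>x. h (- x)) has_real_derivative - y) (at x within S)"
    if "(h has_real_derivative y) (at (- x) within uminus ` S)" for h :: "real \<Rightarrow> real" and x y
  proof -
    have "(uminus has_real_derivative - 1) (at x within S)"
      by (auto intro!: derivative_eq_intros)
    from DERIV_image_chain[OF that this] show ?thesis
      by (simp add: o_def)
  qed
  show ?thesis
    unfolding has_C2_on_def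
  proof (intro ballI conjI)
    fix x assume "x \<in> S"
    then have f: "(f has_real_derivative d (- x)) (at (- x) within uminus ` S)"
      and d: "(d has_real_derivative s (- x)) (at (- x) within uminus ` S)"
      using assms unfolding has_C2_on_def by auto
    show "((\<lambda>x. f (- x)) has_real_derivative - d (- x)) (at x within S)"
      by (rule chain[OF f])
    show "((\<lambda>x. - d (- x)) has_real_derivative s (- x)) (at x within S)"
      using DERIV_minus[OF chain[OF d]] by simp
  qed
qed

text \<open>Nontriviality of these filters, also at the end point \<open>0\<close>, makes the
  one-sided derivatives unique.\<close>

lemma at_within_half_line:
  "x \<le> 0 \<Longrightarrow> at x within {..0::real} \<noteq> bot" "0 \<le> x \<Longrightarrow> at x within {0::real..} \<noteq> bot"
proof -
  have "at_left x \<le> at x within {..0}" if "x \<le> 0"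
    by (rule at_le) (use that in auto)
  then show "x \<le> 0 \<Longrightarrow> at x within {..0::real} \<noteq> bot"
    using trivial_limit_at_left_real[of x] le_bot by (metis trivial_limit_def)
  have "at_right x \<le> at x within {0..}" if "x \<ge> 0"
    by (rule at_le) (use that in auto)
  then show "x \<ge> 0 \<Longrightarrow> at x within {0::real..} \<noteq> bot"
    using trivial_limit_at_right_real[of x] le_bot by (metis trivial_limit_def)
qed

lemma deriv_on_eq:
  assumes "has_C2_on S f d s" "\<And>x. x \<in> S \<Longrightarrow> at x within S \<noteq> bot" "x \<in> S"
  shows "deriv_on S f x = d x" "deriv_on S (deriv_on S f) x = s x"
proof -
  have *: "deriv_on S f x = d x" if "x \<in> S" for x
    unfolding deriv_on_def using assms that
    by (intro vector_derivative_within)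
       (auto simp: has_C2_on_def simp flip: has_real_derivative_iff_has_vector_derivative)
  then show "deriv_on S f x = d x"
    using assms(3) .
  \<comment> \<open>Off \<open>S\<close> the functions \<open>d\<close> and
    \<open>deriv_on S f\<close> may differ, but a derivative within \<open>S\<close> at a point of
    \<open>S\<close> sees only values on \<open>S\<close>.\<close>
  have "has_C2_on S f (deriv_on S f) s"
    by (rule has_C2_on_cong[OF assms(1)]) (simp_all add: *)
  then show "deriv_on S (deriv_on S f) x = s x"
    unfolding deriv_on_def[of S "deriv_on S f"] using assms(2,3)
    by (intro vector_derivative_within)
       (auto simp: has_C2_on_def simp flip: has_real_derivative_iff_has_vector_derivative)
qed

lemma C2_on_iff:
  assumes S: "\<And>x. x \<in> S \<Longrightarrow> at x within S \<noteq> bot"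
  shows "C2_on S f \<longleftrightarrow> (\<exists>d s. has_C2_on S f d s \<and> continuous_on S s)"
proof
  assume C: "C2_on S f"
  have "(h has_real_derivative deriv_on S h x) (at x within S)"
    if "h differentiable_on S" "x \<in> S" for h x
    using that unfolding deriv_on_def has_real_derivative_iff_has_vector_derivative differentiable_on_def
    by (simp flip: vector_derivative_works)
  then have "has_C2_on S f (deriv_on S f) (deriv_on S (deriv_on S f))"
    using C by (auto simp: has_C2_on_def C2_on_def)
  then show "\<exists>d s. has_C2_on S f d s \<and> continuous_on S s"
    using C by (auto simp: C2_on_def)
next
  assume "\<exists>d s. has_C2_on S f d s \<and> continuous_on S s"
  then obtain d s where *: "has_C2_on S f d s" and s: "continuous_on S s"
    by blast
  note eq = deriv_on_eq[OF * S]
  have **: "has_C2_on S f (deriv_on S f) (deriv_on S (deriv_on S f))"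
    by (rule has_C2_on_cong[OF *]) (simp_all add: eq)
  moreover have "continuous_on S (deriv_on S (deriv_on S f))"
    using s by (simp add: eq cong: continuous_on_cong)
  ultimately show "C2_on S f"
    unfolding C2_on_def has_C2_on_def differentiable_on_def
    by (auto simp: real_differentiable_def)
qed

text \<open>Taking \<open>w\<close> from the space encodes three conditions at once: a continuous
  second derivative, equal one-sided second derivatives at \<open>0\<close>, and finite limits at
  both infinities.\<close>

definition Laplace_graph :: "real \<Rightarrow> real \<Rightarrow> cfun_lim \<Rightarrow> cfun_lim \<Rightarrow> bool"
  where "Laplace_graph p q f w \<longleftrightarrow> (\<exists>d1 d2. has_C2_on {..0} (app f) d1 (app w) \<and>
     has_C2_on {0..} (app f) d2 (app w) \<and> p * d2 0 = q * d1 0)"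

lemma Laplace_graph_iff:
  "Laplace_graph p q f w \<longleftrightarrow> f \<in> dom_Laplace_skew p q \<and> Laplace_skew f = w"
proof
  assume "Laplace_graph p q f w"
  then obtain d1 d2 where d1: "has_C2_on {..0} (app f) d1 (app w)"
    and d2: "has_C2_on {0..} (app f) d2 (app w)" and pq: "p * d2 0 = q * d1 0"
    unfolding Laplace_graph_def by blast
  note left = deriv_on_eq[OF d1] at_within_half_line and right = deriv_on_eq[OF d2] at_within_half_line
  have w: "second_deriv (app f) = app w"
    unfolding second_deriv_def using left right by (auto simp: fun_eq_iff)
  have cont: "continuous_on S (app w)" for S
    using app[of w] by (auto intro: continuous_on_subset)
  have C2: "C2_on {..0} (app f)" "C2_on {0..} (app f)"
    using d1 d2 cont at_within_half_line by (subst C2_on_iff; force)+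
  have "f \<in> dom_Laplace_skew p q"
    unfolding dom_Laplace_skew_def
    using C2 app[of w] left right pq by (simp add: w)
  moreover have "Laplace_skew f = w"
    by (simp add: Laplace_skew_def w app_inverse)
  ultimately show "f \<in> dom_Laplace_skew p q \<and> Laplace_skew f = w" ..
next
  assume f: "f \<in> dom_Laplace_skew p q \<and> Laplace_skew f = w"
  then have w: "app w = second_deriv (app f)"
    using app_Laplace_skew by blast
  obtain d1 s1 where d1: "has_C2_on {..0} (app f) d1 s1"
    using f C2_on_iff[of "{..0}" "app f"] at_within_half_line by (auto simp: dom_Laplace_skew_def)
  obtain d2 s2 where d2: "has_C2_on {0..} (app f) d2 s2"
    using f C2_on_iff[of "{0..}" "app f"] at_within_half_line by (auto simp: dom_Laplace_skew_def)
  note left = deriv_on_eq[OF d1] at_within_half_line and right = deriv_on_eq[OF d2] at_within_half_line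
  have 0: "s1 0 = s2 0" "p * d2 0 = q * d1 0"
    using f left right by (auto simp: dom_Laplace_skew_def)
  have "has_C2_on {..0} (app f) d1 (app w)"
    by (rule has_C2_on_cong[OF d1]) (use left in \<open>auto simp: w second_deriv_def\<close>)
  moreover have "has_C2_on {0..} (app f) d2 (app w)"
  proof (rule has_C2_on_cong[OF d2])
    fix x :: real assume "x \<in> {0..}"
    then show "s2 x = app w x"
      \<comment> \<open>At \<open>0\<close> the function \<open>second_deriv\<close> takes the left
        value, so equality of the two one-sided values is needed there.\<close>
      using left right 0 by (cases "x = 0") (auto simp: w second_deriv_def)
  qed auto
  ultimately show "Laplace_graph p q f w"
    using 0 unfolding Laplace_graph_def by blast
qed

text \<open>On each half-line \<open>skew k f\<close> is a linear combination of \<open>f\<close>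
  and its reflection, and reflection commutes with the second derivative. If \<open>a\<close> and
  \<open>b\<close> are the left and right slopes of \<open>f\<close> at \<open>0\<close>, the new
  slopes are \<open>a - k/2 (a + b)\<close> and \<open>b + k/2 (a + b)\<close>; the second
  assumption transfers the transmission condition.\<close>

lemma Laplace_graph_skew:
  assumes "Laplace_graph p q f w"
    and pq': "\<And>a b. p * b = q * a \<Longrightarrow> p' * (b + k / 2 * (a + b)) = q' * (a - k / 2 * (a + b))"
  shows "Laplace_graph p' q' (skew k f) (skew k w)"
proof -
  obtain d1 d2 where d1: "has_C2_on {..0} (app f) d1 (app w)"
    and d2: "has_C2_on {0..} (app f) d2 (app w)" and pq: "p * d2 0 = q * d1 0"
    using assms(1) unfolding Laplace_graph_def by blast
  have r1: "has_C2_on {..0} (\<lambda>x. app f (- x)) (\<lambda>x. - d2 (- x)) (\<lambda>x. app w (- x))"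
    and r2: "has_C2_on {0..} (\<lambda>x. app f (- x)) (\<lambda>x. - d1 (- x)) (\<lambda>x. app w (- x))"
    by (rule has_C2_on_reflect, simp add: d1 d2)+
  have "has_C2_on {..0} (app (skew k f)) (\<lambda>x. (1 - k/2) * d1 x + (k/2) * (- d2 (- x))) (app (skew k w))"
    by (rule has_C2_on_cong[OF has_C2_on_lincomb[OF d1 r1, of "1 - k/2" "k/2"]]) (auto simp: skew.rep_eq field_simps)
  moreover have "has_C2_on {0..} (app (skew k f)) (\<lambda>x. (1 + k/2) * d2 x + (- k/2) * (- d1 (- x))) (app (skew k w))"
    by (rule has_C2_on_cong[OF has_C2_on_lincomb[OF d2 r2, of "1 + k/2" "- k/2"]]) (auto simp: skew.rep_eq field_simps)
  moreover have "p' * ((1 + k/2) * d2 (0::real) + (- k/2) * (- d1 (- 0))) = q' * ((1 - k/2) * d1 0 + (k/2) * (- d2 (- 0)))"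
    using pq'[OF pq] by (simp add: algebra_simps add_divide_distrib)
  ultimately show ?thesis
    unfolding Laplace_graph_def by blast
qed

section \<open>The symmetric case: gluing at the origin and uniqueness\<close>

lemma Laplace_graph_1_1_iff:
  "Laplace_graph 1 1 u w \<longleftrightarrow>
    (\<exists>d. \<forall>x. (app u has_real_derivative d x) (at x) \<and> (d has_real_derivative app w x) (at x))"
proof
  assume "Laplace_graph 1 1 u w"
  then obtain d1 d2 where d1: "has_C2_on {..0} (app u) d1 (app w)"
    and d2: "has_C2_on {0..} (app u) d2 (app w)" and eq: "d2 0 = d1 0"
    unfolding Laplace_graph_def by auto
  define d where "d x = (if x \<le> 0 then d1 x else d2 x)" for x
  have d1': "has_C2_on {..0} (app u) d (app w)"
    by (rule has_C2_on_cong[OF d1]) (auto simp: d_def)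
  have d2': "has_C2_on {0..} (app u) d (app w)"
    by (rule has_C2_on_cong[OF d2]) (auto simp: d_def eq)
  have glue: "(h has_real_derivative y) (at x)"
    if "x \<le> 0 \<Longrightarrow> (h has_real_derivative y) (at x within {..0})"
      "x \<ge> 0 \<Longrightarrow> (h has_real_derivative y) (at x within {0..})" for h y and x :: real
  proof -
    \<comment> \<open>Outside a closed set the filter within it is trivial, so every derivative
      claim holds vacuously. Hence both half-lines can be used at every \<open>x\<close>, and their
      union is the whole line.\<close>
    have *: "(h has_real_derivative y) (at x within S)" if "x \<notin> S" "closed S" for S
    proof -
      have "at x within S = bot"
        using that by (intro not_in_closure_trivial_limitI) (simp add: closure_closed)
      then show ?thesis
        by (simp add: has_field_derivative_iff)
    qed
    have "(h has_real_derivative y) (at x within {..0})"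
      using that(1) by (cases "x \<le> 0") (auto intro: *)
    moreover have "(h has_real_derivative y) (at x within {0..})"
      using that(2) by (cases "x \<ge> 0") (auto intro: *)
    ultimately have "(h has_real_derivative y) (at x within {..0} \<union> {0..})"
      unfolding has_field_derivative_iff by (rule Lim_Un)
    moreover have "{..0::real} \<union> {0..} = UNIV" by auto
    ultimately show ?thesis by simp
  qed
  show "\<exists>d. \<forall>x. (app u has_real_derivative d x) (at x) \<and> (d has_real_derivative app w x) (at x)"
    using d1' d2' by (intro exI[of _ d] allI conjI glue) (auto simp: has_C2_on_def)
next
  assume "\<exists>d. \<forall>x. (app u has_real_derivative d x) (at x) \<and> (d has_real_derivative app w x) (at x)"
  then obtain d where "\<And>S. has_C2_on S (app u) d (app w)"
    unfolding has_C2_on_def using has_field_derivative_at_within by blast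
  then show "Laplace_graph 1 1 u w"
    unfolding Laplace_graph_def by auto
qed

lemma Laplace_graph_1_1_unique:
  assumes "Laplace_graph 1 1 u w" "Laplace_graph 1 1 u' w'" and r: "r > 0"
    and eq: "r\<^sup>2 *\<^sub>R u - w = r\<^sup>2 *\<^sub>R u' - w'"
  shows "u = u'"
proof -
  obtain d d' where d: "\<And>x. (app u has_real_derivative d x) (at x)"
      "\<And>x. (d has_real_derivative app w x) (at x)"
    and d': "\<And>x. (app u' has_real_derivative d' x) (at x)"
      "\<And>x. (d' has_real_derivative app w' x) (at x)"
    using assms(1,2) unfolding Laplace_graph_1_1_iff by blast
  define f g where "f = app (u - u')" and "g x = d x - d' x" for x
  have f: "(f has_real_derivative g x) (at x)" for x
  proof -
    have "f = (\<lambda>x. app u x - app u' x)" by (simp add: f_def fun_eq_iff)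
    then show ?thesis
      unfolding g_def using DERIV_diff[OF d(1) d'(1)] by simp
  qed
  have "app w x - app w' x = r\<^sup>2 * f x" for x
    using arg_cong[OF eq, of "\<lambda>h. app h x"] by (simp add: f_def algebra_simps)
  then have g: "(g has_real_derivative r\<^sup>2 * f x) (at x)" for x
    unfolding g_def using DERIV_diff[OF d(2) d'(2), of x] by simp
  \<comment> \<open>\<open>f'' = r\<^sup>2 f\<close> factors as \<open>(D + s) (D - s) f = 0\<close> for \<open>s = r\<close> and for \<open>s = - r\<close>.\<close>
  have "((\<lambda>x. exp (s * x) * (g x - s * f x)) has_real_derivative 0) (at x)" if "s\<^sup>2 = r\<^sup>2" for s x
    using that
    by (auto intro!: derivative_eq_intros f g simp: algebra_simps power2_eq_square)
  then have const: "exp (s * x) * (g x - s * f x) = g 0 - s * f 0" if "s\<^sup>2 = r\<^sup>2" for s x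
    using DERIV_isconst_all[of "\<lambda>x. exp (s * x) * (g x - s * f x)" x 0] that by auto
  \<comment> \<open>These are the constant values of \<open>exp (s * x) * (g x - s * f x)\<close>
    for \<open>s = r\<close> and \<open>s = - r\<close>.\<close>
  define A B where "A = g 0 - r * f 0" and "B = g 0 + r * f 0"
  have "g x - r * f x = A * exp (- r * x)" "g x + r * f x = B * exp (r * x)" for x
    using const[of r x] const[of "- r" x]
    by (simp_all add: A_def B_def exp_minus field_simps)
  then have sol: "2 * r * f x = B * exp (r * x) - A * exp (- r * x)" for x
    by (metis (no_types, opaque_lifting) add_diff_eq diff_diff_eq2 diff_add_cancel add.commute mult_2 mult.assoc)
  obtain l m where lm: "(f \<longlongrightarrow> l) at_top" "(f \<longlongrightarrow> m) at_bot"
    using app[of "u - u'"] unfolding f_def by blast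
  \<comment> \<open>Multiplication by the decaying exponential isolates the coefficient of the
    growing one: as \<open>f\<close> has a finite limit, the left side tends to \<open>0\<close> and
    the right side to \<open>B\<close>. At minus infinity the same isolates
    \<open>A\<close>.\<close>
  have "exp (- r * x) * (2 * r * f x) = B - A * exp (- 2 * r * x)" for x
    unfolding sol by (simp add: algebra_simps flip: exp_add)
  moreover have "((\<lambda>x. exp (- r * x) * (2 * r * f x)) \<longlongrightarrow> 0 * (2 * r * l)) at_top"
    by (intro tendsto_intros lm) (use r in real_asymp)
  moreover have "((\<lambda>x. B - A * exp (- 2 * r * x)) \<longlongrightarrow> B - A * 0) at_top"
    by (intro tendsto_intros) (use r in real_asymp)
  ultimately have "B = 0"
    using tendsto_unique[OF trivial_limit_at_top_linorder] by fastforce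
  have "exp (r * x) * (2 * r * f x) = B * exp (2 * r * x) - A" for x
    unfolding sol by (simp add: algebra_simps flip: exp_add)
  moreover have "((\<lambda>x. exp (r * x) * (2 * r * f x)) \<longlongrightarrow> 0 * (2 * r * m)) at_bot"
    by (intro tendsto_intros lm) (use r in real_asymp)
  moreover have "((\<lambda>x. B * exp (2 * r * x) - A) \<longlongrightarrow> B * 0 - A) at_bot"
    by (intro tendsto_intros) (use r in real_asymp)
  ultimately have "A = 0"
    using tendsto_unique[OF trivial_limit_at_bot_linorder] by fastforce
  have "app (u - u') x = 0" for x
    using sol[of x] r \<open>A = 0\<close> \<open>B = 0\<close> by (simp add: f_def)
  then show ?thesis
    by (intro cfun_lim_eqI) simp
qed

section \<open>Laplace transforms and the resolvent in the symmetric case\<close>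

text \<open>Differentiation under the integral is avoided: if \<open>V\<close> is an antiderivative
  of \<open>exp (- r * s) * v s\<close> and \<open>C\<close> its limit at infinity, then
  \<open>a x = exp (r * x) * (C - V x)\<close>, and the product rule applies.\<close>

lemma Laplace_transform_translate:
  fixes v :: "real \<Rightarrow> real"
  assumes c: "continuous_on UNIV v" and K: "\<And>x. \<bar>v x\<bar> \<le> K" and r: "r > 0"
  defines "a \<equiv> \<lambda>x. integral {0..} (\<lambda>t. exp (- r * t) * v (x + t))"
  shows "((\<lambda>t. exp (- r * t) * v (x + t)) has_integral a x) {0..}"
    and "(a has_real_derivative r * a x - v x) (at x)"
proof -
  have int: "((\<lambda>t. exp (- r * t) * v (x + t)) has_integral a x) {0..}" for x
  proof -
    have "continuous_on {0..} (\<lambda>t. v (x + t))"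
      by (rule continuous_on_compose2[OF c]) (auto intro!: continuous_intros)
    from integrable_exp_decay[OF this, of K r] show ?thesis
      unfolding a_def using K r by (auto intro!: integrable_integral)
  qed
  then show "((\<lambda>t. exp (- r * t) * v (x + t)) has_integral a x) {0..}" .
  have "isCont (\<lambda>s. exp (- r * s) * v s) s" for s
    using c by (auto intro!: continuous_intros simp: continuous_on_eq_continuous_at)
  then obtain V where V: "\<And>s. (V has_real_derivative exp (- r * s) * v s) (at s)"
    using einterval_antiderivative[of "-\<infinity>" \<infinity> "\<lambda>s. exp (- r * s) * v s"]
    by (auto simp: has_real_derivative_iff_has_vector_derivative)
  have lim: "((\<lambda>b. exp (r * x) * (V (x + b) - V x)) \<longlongrightarrow> a x) at_top" for x
  proof (rule Lim_transform_eventually[OF tendsto_integral_atLeast[OF int]])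
    show "\<forall>\<^sub>F b in at_top. integral {0..b} (\<lambda>t. exp (- r * t) * v (x + t)) = exp (r * x) * (V (x + b) - V x)"
      using eventually_ge_at_top[of 0]
    proof eventually_elim
      case (elim b)
      have "((\<lambda>t. exp (- r * t) * v (x + t)) has_integral exp (r * x) * V (x + b) - exp (r * x) * V (x + 0)) {0..b}"
      proof (rule fundamental_theorem_of_calculus[OF elim])
        fix t
        have "((\<lambda>t. exp (r * x) * V (x + t)) has_real_derivative exp (r * x) * (exp (- r * (x + t)) * v (x + t))) (at t)"
          by (intro DERIV_cmult DERIV_chain2[OF V, THEN DERIV_cong]) (auto intro!: derivative_eq_intros)
        also have "exp (r * x) * (exp (- r * (x + t)) * v (x + t)) = exp (- r * t) * v (x + t)"
          by (simp add: algebra_simps flip: exp_add mult.assoc)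
        finally show "((\<lambda>t. exp (r * x) * V (x + t)) has_vector_derivative exp (- r * t) * v (x + t)) (at t within {0..b})"
          unfolding has_real_derivative_iff_has_vector_derivative[symmetric]
          by (rule has_field_derivative_at_within)
      qed
      then show ?case
        by (simp add: integral_unique right_diff_distrib)
    qed
  qed
  \<comment> \<open>The case \<open>x = 0\<close> of \<open>lim\<close> shows that \<open>V\<close>
    converges, and identifies the constant \<open>C\<close>.\<close>
  have V_lim: "(V \<longlongrightarrow> a 0 + V 0) at_top"
    using tendsto_add[OF lim[of 0] tendsto_const[of "V 0"]] by simp
  have "a = (\<lambda>x. exp (r * x) * (a 0 + V 0 - V x))"
  proof
    fix x :: real
    have "filterlim (\<lambda>b. x + b) at_top at_top"
      by (rule filterlim_tendsto_add_at_top[OF tendsto_const filterlim_ident])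
    then have "((\<lambda>b. exp (r * x) * (V (x + b) - V x)) \<longlongrightarrow> exp (r * x) * (a 0 + V 0 - V x)) at_top"
      by (intro tendsto_intros filterlim_compose[OF V_lim])
    then show "a x = exp (r * x) * (a 0 + V 0 - V x)"
      using tendsto_unique[OF trivial_limit_at_top_linorder lim] by blast
  qed
  then obtain C where C: "a = (\<lambda>x. exp (r * x) * (C - V x))"
    by blast
  have "((\<lambda>x. exp (r * x) * (C - V x)) has_real_derivative
      r * (exp (r * x) * (C - V x)) - exp (r * x) * (exp (- r * x) * v x)) (at x)"
    by (auto intro!: derivative_eq_intros V simp: algebra_simps)
  moreover have "exp (r * x) * (exp (- r * x) * v x) = v x"
    by (simp add: exp_minus)
  ultimately show "(a has_real_derivative r * a x - v x) (at x)"
    unfolding C by (simp only:)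
qed

lemma resolvent_cos_std:
  assumes r: "r > 0"
  shows "\<exists>u. Laplace_graph 1 1 u (r\<^sup>2 *\<^sub>R u - v) \<and>
    ((\<lambda>t. exp (- r * t) *\<^sub>R cos_std t v) has_integral r *\<^sub>R u) {0..}"
proof -
  define J where "J = integral {0..} (\<lambda>t. exp (- r * t) *\<^sub>R cos_std t v)"
  have J: "((\<lambda>t. exp (- r * t) *\<^sub>R cos_std t v) has_integral J) {0..}"
    unfolding J_def
    by (intro integrable_integral integrable_exp_decay[OF _ norm_cos_std_le r]
        continuous_on_subset[OF continuous_on_cos_std]) auto
  define u where "u = (1 / r) *\<^sub>R J"
  have cont: "continuous_on UNIV (app v)"
    using app[of v] by auto
  then have cont': "continuous_on UNIV (\<lambda>x. app v (- x))"
    by (rule continuous_on_compose2) (auto intro!: continuous_intros)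
  define a where "a x = integral {0..} (\<lambda>t. exp (- r * t) * app v (x + t))" for x
  \<comment> \<open>This is the transform of the reflected function; at \<open>- x\<close> its
    integrand involves \<open>app v (x - t)\<close>, the backward half of d'Alembert's
    formula.\<close>
  define b where "b x = integral {0..} (\<lambda>t. exp (- r * t) * app v (- (x + t)))" for x
  note a = Laplace_transform_translate[OF cont abs_app_le_norm r, folded a_def]
  note b = Laplace_transform_translate[OF cont' abs_app_le_norm r, folded b_def]
  have b': "((\<lambda>x. b (- x)) has_real_derivative app v x - r * b (- x)) (at x)" for x
  proof -
    have "(uminus has_real_derivative - 1) (at x)"
      by (auto intro!: derivative_eq_intros)
    from DERIV_chain2[OF b(2) this] show ?thesis
      by simp
  qed
  \<comment> \<open>Evaluation at \<open>x\<close> is bounded and linear, so it passes inside the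
    Banach-valued integral.\<close>
  have J_eq: "app J x = (a x + b (- x)) / 2" for x
  proof -
    have "((\<lambda>t. exp (- r * t) * app (cos_std t v) x) has_integral app J x) {0..}"
      using has_integral_linear[OF J bounded_linear_app, of x] by (simp add: o_def)
    moreover have "((\<lambda>t. exp (- r * t) * app (cos_std t v) x) has_integral (a x + b (- x)) / 2) {0..}"
      using has_integral_divide[OF has_integral_add[OF a(1)[of x] b(1)[of "- x"]], of 2]
      by (simp add: app_cos_std algebra_simps add_divide_distrib)
    ultimately show ?thesis
      by (rule has_integral_unique)
  qed
  have u: "app u = (\<lambda>x. (a x + b (- x)) / (2 * r))"
    by (simp add: u_def J_eq fun_eq_iff)
  \<comment> \<open>In the derivative of \<open>a x + b (- x)\<close> the two terms with
    \<open>v\<close> cancel; in that of \<open>a x - b (- x)\<close> they add up, which yields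
    \<open>r\<^sup>2 u - v\<close>.\<close>
  have "(app u has_real_derivative (a x - b (- x)) / 2) (at x)" for x
    unfolding u using r by (auto intro!: derivative_eq_intros a(2) b' simp: field_simps)
  moreover have "((\<lambda>x. (a x - b (- x)) / 2) has_real_derivative app (r\<^sup>2 *\<^sub>R u - v) x) (at x)" for x
    using r by (auto intro!: derivative_eq_intros a(2) b' simp: u field_simps power2_eq_square)
  ultimately have "Laplace_graph 1 1 u (r\<^sup>2 *\<^sub>R u - v)"
    unfolding Laplace_graph_1_1_iff by (intro exI[of _ "\<lambda>x. (a x - b (- x)) / 2"]) simp
  moreover have "r *\<^sub>R u = J"
    using r by (simp add: u_def)
  ultimately show ?thesis
    using J by metis
qed

section \<open>Transfer to general \<open>p\<close> and \<open>q\<close>\<close>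

theorem theorem6p6:
  fixes p q :: real
  assumes "p \<ge> 0" and "q \<ge> 0" and "p + q > 0"
  shows "strongly_continuous_cosine_family (cos_skew p q) \<and>
    cosine_generator (cos_skew p q) (dom_Laplace_skew p q) Laplace_skew \<and>
    (\<forall>t. onorm (cos_skew p q t) \<le> 2 * max p q / (p + q))"
proof -
  define k where "k = (p - q) / (p + q)"
  have norm: "onorm (cos_skew p q t) \<le> 2 * max p q / (p + q)" for t
    by (rule onorm_bound) (use assms norm_cos_skew_le[OF assms] in \<open>auto simp: max_def\<close>)
  have lin: "skew j (c *\<^sub>R f - g) = c *\<^sub>R skew j f - skew j g" for j c f g
    by (rule cfun_lim_eqI) (simp add: skew.rep_eq algebra_simps)
  \<comment> \<open>A function with equal slopes \<open>a\<close> at \<open>0\<close> is sent by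
    \<open>skew (- k)\<close> to one with right slope \<open>(1 - k) a\<close> and left slope
    \<open>(1 + k) a\<close>, so this identity is the transmission condition.\<close>
  have k: "p * (1 - k) = q * (1 + k)"
    using assms by (simp add: k_def field_simps)
  have pk: "p = (p + q) * (1 + k) / 2" "q = (p + q) * (1 - k) / 2"
    using assms by (auto simp: k_def field_simps)
  have to_std: "Laplace_graph 1 1 (skew k f) (skew k w)" if "Laplace_graph p q f w" for f w
  proof (rule Laplace_graph_skew[OF that])
    fix a b :: real assume "p * b = q * a"
    \<comment> \<open>Equality of the two slopes of \<open>skew k f\<close> amounts to
      \<open>(1 + k) b = (1 - k) a\<close>.\<close>
    then have "(p + q) * ((1 + k) * b) = (p + q) * ((1 - k) * a)"
      using pk by (metis (no_types, opaque_lifting) mult.assoc times_divide_eq_left divide_cancel_right zero_neq_numeral)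
    then have "(1 + k) * b = (1 - k) * a"
      using assms by simp
    then show "1 * (b + k / 2 * (a + b)) = 1 * (a - k / 2 * (a + b))"
      by (simp add: algebra_simps)
  qed
  have from_std: "Laplace_graph p q (skew (- k) u) (skew (- k) w)" if "Laplace_graph 1 1 u w" for u w
  proof (rule Laplace_graph_skew[OF that])
    fix a b :: real assume "1 * b = 1 * a"
    then show "p * (b + - k / 2 * (a + b)) = q * (a - - k / 2 * (a + b))"
      using arg_cong[OF k, of "\<lambda>z. z * a"] by (simp add: algebra_simps)
  qed
  have generator: "bij_betw (\<lambda>f. r\<^sup>2 *\<^sub>R f - Laplace_skew f) (dom_Laplace_skew p q) UNIV \<and>
      (\<forall>g. ((\<lambda>t. exp (- r * t) *\<^sub>R cos_skew p q t g) has_integral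
        r *\<^sub>R inv_into (dom_Laplace_skew p q) (\<lambda>f. r\<^sup>2 *\<^sub>R f - Laplace_skew f) g) {0..})"
    if r: "r > 0" for r :: real
  proof -
    let ?D = "dom_Laplace_skew p q" and ?L = "\<lambda>f. r\<^sup>2 *\<^sub>R f - Laplace_skew f"
    have graph: "Laplace_graph 1 1 (skew k f) (skew k (Laplace_skew f))" if "f \<in> ?D" for f
      using that to_std Laplace_graph_iff by blast
    have inj: "inj_on ?L ?D"
    proof (rule inj_onI)
      fix f g assume "f \<in> ?D" "g \<in> ?D" "?L f = ?L g"
      then have "skew k f = skew k g"
        using Laplace_graph_1_1_unique[OF graph graph r] by (metis lin)
      then show "f = g"
        by (metis skew_skew_minus(2))
    qed
    have solution: "\<exists>f\<in>?D. ?L f = g \<and> ((\<lambda>t. exp (- r * t) *\<^sub>R cos_skew p q t g) has_integral r *\<^sub>R f) {0..}"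
      for g
    proof -
      obtain u where u: "Laplace_graph 1 1 u (r\<^sup>2 *\<^sub>R u - skew k g)"
        and int: "((\<lambda>t. exp (- r * t) *\<^sub>R cos_std t (skew k g)) has_integral r *\<^sub>R u) {0..}"
        using resolvent_cos_std[OF r] by blast
      have "Laplace_graph p q (skew (- k) u) (r\<^sup>2 *\<^sub>R skew (- k) u - g)"
        using from_std[OF u] by (simp add: lin)
      then have "skew (- k) u \<in> ?D" "?L (skew (- k) u) = g"
        by (auto simp: Laplace_graph_iff)
      moreover have "((\<lambda>t. exp (- r * t) *\<^sub>R cos_skew p q t g) has_integral r *\<^sub>R skew (- k) u) {0..}"
        using has_integral_linear[OF int bounded_linear_skew[of "- k"]]
        by (simp add: o_def cos_skew_conv[OF k_def]
            linear_scale[OF bounded_linear.linear[OF bounded_linear_skew]])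
      ultimately show ?thesis by blast
    qed
    have "g \<in> ?L ` ?D" for g
      using solution[of g] by blast
    then have "bij_betw ?L ?D UNIV"
      using inj by (auto simp: bij_betw_def)
    moreover have "((\<lambda>t. exp (- r * t) *\<^sub>R cos_skew p q t g) has_integral r *\<^sub>R inv_into ?D ?L g) {0..}" for g
    proof -
      obtain f where f: "f \<in> ?D" "?L f = g"
        and int: "((\<lambda>t. exp (- r * t) *\<^sub>R cos_skew p q t g) has_integral r *\<^sub>R f) {0..}"
        using solution by blast
      \<comment> \<open>By injectivity the inverse picks the solution whose integral formula is
        known.\<close>
      have "inv_into ?D ?L g = f"
        using inv_into_f_f[OF inj f(1)] f(2) by simp
      then show ?thesis
        using int by simp
    qed
    ultimately show ?thesis by blast
  qed
  show ?thesis
    using cosine_family_cos_skew generator norm unfolding cosine_generator_def by blast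
qed

end
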